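(* Let $N\ge 1$ and let $\mathcal H_Q=(\mathbb C^2)^{\otimes N}$ be the Hilbert space of an $N$-qubit register. Any $N$-qubit pure state $\rho_d=|\psi\rangle\langle\psi|$ can be deterministically prepared in $N$ control steps, irrespective of the initial state, using arbitrary unitary control on the register, one resettable ancilla qubit, and the two controlled-not gates $C_{\mathrm{in}},C_{\mathrm{out}}$ between the ancilla and the first register qubit. Explicitly: for every unit vector $|\psi\rangle\in\mathcal H_Q$ there exist unitary operators $U_1,\dots,U_N$ on $\mathcal H_Q$ such that for every density operator $\rho$ on $\mathcal H_Q$, $$\mathcal E_{U_N}\circ\cdots\circ\mathcal E_{U_1}(\rho)=|\psi\rangle\langle\psi|,$$ where $\mathcal E_U$ is the map on density operators of $\mathcal H_Q$ implemented by one control step with register unitary $U$.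
   Context: A density operator on a finite-dimensional Hilbert space is a positive semidefinite operator of trace one. The register is $\mathcal H_Q=\mathcal H_1\otimes\cdots\otimes\mathcal H_N$ with each $\mathcal H_j\cong\mathbb C^2$ having standard basis $|0\rangle,|1\rangle$. The ancilla (control) qubit has Hilbert space $\mathcal H_c\cong\mathbb C^2$ and can be reset to the pure state $|1\rangle$. Write $\sigma_x$ for the Pauli matrix exchanging $|0\rangle$ and $|1\rangle$, and $I_2$ for the $2\times 2$ identity. Available control resources: (s1) arbitrary unitary operators on the $N$ register qubits; (s2) an ancilla qubit $\mathcal H_c$ that can be reset to $|1\rangle$; (s3) the controlled-not unitaries on $\mathcal H_c\otimes\mathcal H_1$ (ancilla first, first register qubit second), extended by the identity on the other register qubits to $\mathcal H_c\otimes\mathcal H_Q$: $$C_{\mathrm{out}}=I_2\otimes|0\rangle\langle 0|+\sigma_x\otimes|1\rangle\langle 1|,\qquad C_{\mathrm{in}}=|1\rangle\langle 1|\otimes I_2+|0\rangle\langle 0|\otimes\sigma_x .$$ A control step with register unitary $U$ is the following sequence, starting with the ancilla in state $|1\rangle$: (1) apply $U^\dagger$ to the register; (2) apply $C_{\mathrm{out}}$; (3) apply $C_{\mathrm{in}}$; (4) apply $U$ to the register, and reset the ancilla to $|1\rangle$ for the next step. Its effect on the register state is $$\mathcal E_U(\rho)=\operatorname{tr}_{\mathcal H_c}\!\left\{U_{\mathrm{tot}}\,\big(|1\rangle\langle 1|\otimes\rho\big)\,U_{\mathrm{tot}}^\dagger\right\},\qquad U_{\mathrm{tot}}=(I_2\otimes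 U)\,C_{\mathrm{in}}\,C_{\mathrm{out}}\,(I_2\otimes U^\dagger),$$ where $\operatorname{tr}_{\mathcal H_c}$ is the partial trace over $\mathcal H_c$. The unitary $U$ may differ from step to step, while $C_{\mathrm{in}}$, $C_{\mathrm{out}}$ and the reset are the same at each step. *)

theory Defs
  imports "Jordan_Normal_Form.Schur_Decomposition"
begin

text \<open>Operators on an \<open>n\<close>-dimensional Hilbert space are complex \<open>n \<times> n\<close> matrices in the
  standard basis.  Vectors of \<open>(\<complex>\<^sup>2)\<^sup>\<otimes>\<^sup>N\<close> are complex vectors of length \<open>2 ^ N\<close>, with the first
  tensor factor as the most significant digit of the binary basis index (the usual Kronecker
  product convention).\<close>

definition kron :: "complex mat \<Rightarrow> complex mat \<Rightarrow> complex mat"  (infixr "\<otimes>\<^sub>K" 71) where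
  "A \<otimes>\<^sub>K B = mat (dim_row A * dim_row B) (dim_col A * dim_col B)
     (\<lambda>(i, j). A $$ (i div dim_row B, j div dim_col B) * B $$ (i mod dim_row B, j mod dim_col B))"

definition ketbra :: "complex vec \<Rightarrow> complex vec \<Rightarrow> complex mat" where
  "ketbra v w = mat (dim_vec v) (dim_vec w) (\<lambda>(i, j). v $ i * conjugate (w $ j))"

definition is_unitary :: "nat \<Rightarrow> complex mat \<Rightarrow> bool" where
  "is_unitary n U \<longleftrightarrow>
     U \<in> carrier_mat n n \<and> mat_adjoint U * U = 1\<^sub>m n \<and> U * mat_adjoint U = 1\<^sub>m n"

definition mat_trace :: "complex mat \<Rightarrow> complex" where
  "mat_trace A = (\<Sum>i<dim_row A. A $$ (i, i))"

text \<open>The order on \<^typ>\<open>complex\<close> makes \<open>0 \<le> z\<close> say that \<open>z\<close> is real and nonnegative, and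
  \<open>(A *\<^sub>v v) \<bullet>c v\<close> is \<open>\<langle>v|A|v\<rangle>\<close>; so \<open>A\<close> is in particular Hermitian.\<close>

definition pos_semidef :: "nat \<Rightarrow> complex mat \<Rightarrow> bool" where
  "pos_semidef n A \<longleftrightarrow> A \<in> carrier_mat n n \<and> (\<forall>v \<in> carrier_vec n. 0 \<le> (A *\<^sub>v v) \<bullet>c v)"

definition density_operator :: "nat \<Rightarrow> complex mat \<Rightarrow> bool" where
  "density_operator n \<rho> \<longleftrightarrow> pos_semidef n \<rho> \<and> mat_trace \<rho> = 1"

text \<open>Partial trace over the \<open>\<complex>\<^sup>2\<close> factor of \<open>\<complex>\<^sup>2 \<otimes> \<complex>\<^sup>n\<close>: the sum of the two diagonal
  \<open>n \<times> n\<close> blocks.\<close>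

definition ptrace_qubit :: "nat \<Rightarrow> complex mat \<Rightarrow> complex mat" where
  "ptrace_qubit n M = mat n n (\<lambda>(i, j). \<Sum>k<2. M $$ (k * n + i, k * n + j))"

definition proj :: "nat \<Rightarrow> complex mat" where
  "proj b = ketbra (unit_vec 2 b) (unit_vec 2 b)"

definition sigma_x :: "complex mat" where
  "sigma_x = mat_of_rows_list 2 [[0, 1], [1, 0]]"

definition C_out :: "nat \<Rightarrow> complex mat" where
  "C_out N = (1\<^sub>m 2 \<otimes>\<^sub>K proj 0 + sigma_x \<otimes>\<^sub>K proj 1) \<otimes>\<^sub>K 1\<^sub>m (2 ^ (N - 1))"

definition C_in :: "nat \<Rightarrow> complex mat" where
  "C_in N = (proj 1 \<otimes>\<^sub>K 1\<^sub>m 2 + proj 0 \<otimes>\<^sub>K sigma_x) \<otimes>\<^sub>K 1\<^sub>m (2 ^ (N - 1))"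

definition U_tot :: "nat \<Rightarrow> complex mat \<Rightarrow> complex mat" where
  "U_tot N U = (1\<^sub>m 2 \<otimes>\<^sub>K U) * C_in N * C_out N * (1\<^sub>m 2 \<otimes>\<^sub>K mat_adjoint U)"

definition control_step :: "nat \<Rightarrow> complex mat \<Rightarrow> complex mat \<Rightarrow> complex mat" where
  "control_step N U \<rho> =
     ptrace_qubit (2 ^ N) (U_tot N U * (proj 1 \<otimes>\<^sub>K \<rho>) * mat_adjoint (U_tot N U))"

end

theory Submission
  imports Defs
begin

text \<open>With \<open>U = 1\<close>, a control step resets the first qubit to \<open>|0\<rangle>\<close> and traces out its old value:
  it moves the lower right diagonal block of \<open>\<rho>\<close> onto the upper left one, without coherences.
  Conjugating by a basis permutation that places the occupied basis states evenly in both halves,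
  each step halves the number of occupied states, so \<open>N\<close> steps concentrate all the trace on \<open>|0\<dots>0\<rangle>\<close>.
  Composing every permutation with one unitary \<open>V\<close> with \<open>V|0\<dots>0\<rangle> = |\<psi>\<rangle>\<close> conjugates the whole
  process by \<open>V\<close>, because the factors \<open>V\<^sup>\<dagger>V\<close> between consecutive steps cancel.\<close>

section \<open>Kronecker products, adjoints, trace and unitaries\<close>

lemma index_kron [simp]:
  "i < dim_row A * dim_row B \<Longrightarrow> j < dim_col A * dim_col B \<Longrightarrow> (A \<otimes>\<^sub>K B) $$ (i, j) =
     A $$ (i div dim_row B, j div dim_col B) * B $$ (i mod dim_row B, j mod dim_col B)"
  "dim_row (A \<otimes>\<^sub>K B) = dim_row A * dim_row B"
  "dim_col (A \<otimes>\<^sub>K B) = dim_col A * dim_col B"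
  by (simp_all add: kron_def)

text \<open>A row or column index has three mixed-radix digits, and both groupings extract the same
  ones. The gates are written as an operator on ancilla and first qubit tensored with an identity;
  regrouping turns them into sums of ancilla operators tensored with register operators.\<close>

lemma kron_assoc: "(A \<otimes>\<^sub>K B) \<otimes>\<^sub>K C = A \<otimes>\<^sub>K B \<otimes>\<^sub>K C"
proof (rule eq_matI)
  fix i j
  assume i: "i < dim_row (A \<otimes>\<^sub>K B \<otimes>\<^sub>K C)" and j: "j < dim_col (A \<otimes>\<^sub>K B \<otimes>\<^sub>K C)"
  have split: "k div c < a * b" "k mod (b * c) < b * c" "k div (b * c) = k div c div b"
    "k mod (b * c) div c = k div c mod b" "k mod (b * c) mod c = k mod c"
    if "k < a * (b * c)" for k a b c :: nat
  proof -
    have pos: "b > 0" "c > 0"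
      using that by (auto intro: Nat.gr0I)
    show "k div c < a * b"
      using that by (simp add: less_mult_imp_div_less mult.assoc)
    show "k mod (b * c) < b * c"
      using pos by simp
    show "k div (b * c) = k div c div b"
      by (metis div_mult2_eq mult.commute)
    show "k mod (b * c) div c = k div c mod b"
      using pos by (subst mult.commute) (simp add: mod_mult2_eq)
    show "k mod (b * c) mod c = k mod c"
      by (simp add: mod_mod_cancel)
  qed
  note si = split[of i "dim_row A" "dim_row B" "dim_row C"]
  note sj = split[of j "dim_col A" "dim_col B" "dim_col C"]
  show "((A \<otimes>\<^sub>K B) \<otimes>\<^sub>K C) $$ (i, j) = (A \<otimes>\<^sub>K B \<otimes>\<^sub>K C) $$ (i, j)"
    using i j si sj by (simp add: mult.assoc)
qed (simp_all add: mult.assoc)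

lemma kron_add_left:
  assumes "A \<in> carrier_mat r c" "B \<in> carrier_mat r c"
  shows "(A + B) \<otimes>\<^sub>K C = A \<otimes>\<^sub>K C + B \<otimes>\<^sub>K C"
  using assms
  by (intro eq_matI) (auto simp: less_mult_imp_div_less distrib_right)

text \<open>The left factor supplies the most significant digit, so for a qubit it is the block
  number. This serves both for the ancilla against the register and for the first register qubit
  against the others.\<close>

lemma kron_qubit:
  assumes "A \<in> carrier_mat 2 2" "B \<in> carrier_mat n n"
  shows "A \<otimes>\<^sub>K B = four_block_mat (A $$ (0, 0) \<cdot>\<^sub>m B) (A $$ (0, 1) \<cdot>\<^sub>m B)
    (A $$ (1, 0) \<cdot>\<^sub>m B) (A $$ (1, 1) \<cdot>\<^sub>m B)" (is "_ = ?R")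
proof (rule eq_matI)
  fix i j
  assume "i < dim_row ?R" "j < dim_col ?R"
  then have ij: "i < 2 * n" "j < 2 * n"
    using assms by auto
  have split: "k div n = (if k < n then 0 else 1)" "k mod n = (if k < n then k else k - n)"
    if "k < 2 * n" for k
    using that by (auto simp: div_if mod_if)
  show "(A \<otimes>\<^sub>K B) $$ (i, j) = ?R $$ (i, j)"
    using ij assms by (auto simp: split)
qed (use assms in auto)

lemma index_mat_adjoint [simp]:
  "i < dim_col A \<Longrightarrow> j < dim_row A \<Longrightarrow> mat_adjoint A $$ (i, j) = conjugate (A $$ (j, i))"
  "dim_row (mat_adjoint A) = dim_col A"
  "dim_col (mat_adjoint A) = dim_row A"
  by (simp_all add: mat_adjoint_def mat_of_rows_index)

lemma mat_adjoint_carrier [simp]: "A \<in> carrier_mat r c \<Longrightarrow> mat_adjoint A \<in> carrier_mat c r"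
  by (metis carrier_matD carrier_matI index_mat_adjoint(2,3))

lemma mat_adjoint_adjoint [simp]: "mat_adjoint (mat_adjoint A) = A"
  by (rule eq_matI) auto

lemma mat_adjoint_mult:
  fixes A :: "complex mat"
  assumes "A \<in> carrier_mat r n" "B \<in> carrier_mat n c"
  shows "mat_adjoint (A * B) = mat_adjoint B * mat_adjoint A"
  using assms
  by (intro eq_matI) (auto simp: scalar_prod_def sum_conjugate conjugate_dist_mul mult.commute)

lemma mat_adjoint_four_block:
  assumes "A \<in> carrier_mat r1 c1" "B \<in> carrier_mat r1 c2"
    "C \<in> carrier_mat r2 c1" "D \<in> carrier_mat r2 c2"
  shows "mat_adjoint (four_block_mat A B C D) =
    four_block_mat (mat_adjoint A) (mat_adjoint C) (mat_adjoint B) (mat_adjoint D)"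
  using assms by (intro eq_matI) auto

lemma mat_trace_comm:
  assumes "A \<in> carrier_mat r c" "B \<in> carrier_mat c r"
  shows "mat_trace (A * B) = mat_trace (B * A)"
proof -
  have "mat_trace (A * B) = (\<Sum>i<r. \<Sum>j<c. A $$ (i, j) * B $$ (j, i))"
    using assms by (simp add: mat_trace_def scalar_prod_def atLeast0LessThan)
  also have "\<dots> = (\<Sum>j<c. \<Sum>i<r. B $$ (j, i) * A $$ (i, j))"
    by (subst sum.swap) (simp add: mult.commute)
  also have "\<dots> = mat_trace (B * A)"
    using assms by (simp add: mat_trace_def scalar_prod_def atLeast0LessThan)
  finally show ?thesis .
qed

lemma is_unitaryD:
  assumes "is_unitary n U"
  shows "U \<in> carrier_mat n n" "mat_adjoint U * U = 1\<^sub>m n" "U * mat_adjoint U = 1\<^sub>m n"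
  using assms by (auto simp: is_unitary_def)

lemma square_mult_carrier [simp]:
  "A \<in> carrier_mat n n \<Longrightarrow> B \<in> carrier_mat n n \<Longrightarrow> A * B \<in> carrier_mat n n"
  by simp

lemma is_unitary_mult:
  assumes U: "is_unitary n U" and V: "is_unitary n V"
  shows "is_unitary n (U * V)"
proof -
  note [simp] = is_unitaryD(1)[OF U] is_unitaryD(1)[OF V]
  have "mat_adjoint V * mat_adjoint U * (U * V) = mat_adjoint V * (mat_adjoint U * U) * V"
    by (simp add: assoc_mult_mat[of _ n n _ n _ n])
  moreover have "U * V * (mat_adjoint V * mat_adjoint U) = U * (V * mat_adjoint V) * mat_adjoint U"
    by (simp add: assoc_mult_mat[of _ n n _ n _ n])
  ultimately show ?thesis
    using is_unitaryD(2,3)[OF U] is_unitaryD(2,3)[OF V]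
    by (simp add: is_unitary_def mat_adjoint_mult[of _ n n _ n] right_mult_one_mat[of _ n n])
qed

section \<open>Selection matrices and the gates in block form\<close>

text \<open>Multiplying from the left by this 0/1 matrix puts row \<open>f i\<close> of the other
  factor into row \<open>i\<close>, or zero where \<open>D i\<close> fails. Projections
  (\<open>f = id\<close>), permutations (\<open>D\<close> always true) and truncated shifts are all
  of this shape.\<close>

definition sel_mat :: "nat \<Rightarrow> (nat \<Rightarrow> bool) \<Rightarrow> (nat \<Rightarrow> nat) \<Rightarrow> complex mat" where
  "sel_mat n D f = mat n n (\<lambda>(i, j). if D i \<and> j = f i then 1 else 0)"

lemma sel_mat_carrier [simp]: "sel_mat n D f \<in> carrier_mat n n"
  "dim_row (sel_mat n D f) = n" "dim_col (sel_mat n D f) = n"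
  by (auto simp: sel_mat_def)

text \<open>Each row has at most one nonzero entry, so every sum in the two products collapses to
  one term. The range condition on \<open>f\<close> ensures that this entry really lies inside the
  matrix.\<close>

lemma sel_mat_conj:
  assumes X: "X \<in> carrier_mat n n" and f: "\<And>i. i < n \<Longrightarrow> D i \<Longrightarrow> f i < n"
  shows "sel_mat n D f * X * mat_adjoint (sel_mat n D f) =
    mat n n (\<lambda>(i, j). if D i \<and> D j then X $$ (f i, f j) else 0)"
proof -
  have "sel_mat n D f * X = mat n n (\<lambda>(i, j). if D i then X $$ (f i, j) else 0)"
    using X f
    by (intro eq_matI)
      (auto simp: scalar_prod_def sel_mat_def if_distrib[of "\<lambda>x. x * _"] sum.delta cong: if_cong)
  then show ?thesis
    using X f
    by (intro eq_matI)
      (auto simp: scalar_prod_def sel_mat_def if_distrib[of "\<lambda>x. _ * x"] if_distrib[of cnj] sum.delta cong: if_cong)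
qed

lemma proj_carrier [simp]: "proj b \<in> carrier_mat 2 2"
  and index_proj [simp]: "i < 2 \<Longrightarrow> j < 2 \<Longrightarrow> proj b $$ (i, j) = (if i = b \<and> j = b then 1 else 0)"
  by (auto simp: proj_def ketbra_def unit_vec_def)

lemma sigma_x_carrier [simp]: "sigma_x \<in> carrier_mat 2 2"
  and index_sigma_x [simp]: "i < 2 \<Longrightarrow> j < 2 \<Longrightarrow> sigma_x $$ (i, j) = (if i = j then 0 else 1)"
  by (auto simp: sigma_x_def mat_of_rows_list_def less_2_cases_iff)

lemma kron_carrier [simp]:
  "A \<in> carrier_mat r c \<Longrightarrow> B \<in> carrier_mat r' c' \<Longrightarrow> A \<otimes>\<^sub>K B \<in> carrier_mat (r * r') (c * c')"
  by (auto simp: kron_def)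

text \<open>This is |0><0| tensored with the partial trace of \<open>X\<close> over the first qubit,
  where \<open>h\<close> is the dimension of the remaining qubits.\<close>

definition reset_half :: "nat \<Rightarrow> complex mat \<Rightarrow> complex mat" where
  "reset_half h X =
     mat (2 * h) (2 * h) (\<lambda>(i, j). if i < h \<and> j < h then X $$ (i, j) + X $$ (i + h, j + h) else 0)"

text \<open>An ancilla starting in |1> sees only the second block column, whose two blocks are the
  Kraus operators of the reduced map.\<close>

lemma ptrace_qubit_conj:
  assumes "A \<in> carrier_mat n n" "B \<in> carrier_mat n n" "C \<in> carrier_mat n n" "D \<in> carrier_mat n n"
    and "\<rho> \<in> carrier_mat n n"
  shows "ptrace_qubit n (four_block_mat A B C D * (proj 1 \<otimes>\<^sub>K \<rho>) * mat_adjoint (four_block_mat A B C D))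
    = B * \<rho> * mat_adjoint B + D * \<rho> * mat_adjoint D"
proof -
  have proj: "proj 1 \<otimes>\<^sub>K \<rho> = four_block_mat (0\<^sub>m n n) (0\<^sub>m n n) (0\<^sub>m n n) \<rho>"
    using assms
    by (subst kron_qubit[of _ _ n]) (auto intro!: cong_four_block_mat)
  show ?thesis
    unfolding proj mat_adjoint_four_block[OF assms(1-4)]
    using assms
    by (simp add: mult_four_block_mat[of _ n n _ n _ n _ _ n _ n] ptrace_qubit_def)
       (intro eq_matI, auto simp: numeral_2_eq_2)
qed

text \<open>The first register qubit is the leading binary digit, so it is |0> exactly for indices
  below \<open>h\<close>. The ancilla keeps its value on those indices (diagonal blocks) and is
  flipped on the others (off-diagonal blocks).\<close>

lemma C_out_four_block:
  assumes "1 \<le> N"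
  defines "n \<equiv> 2 ^ N" and "h \<equiv> 2 ^ (N - 1)"
  shows "C_out N = four_block_mat (sel_mat n (\<lambda>i. i < h) id) (sel_mat n (\<lambda>i. \<not> i < h) id)
    (sel_mat n (\<lambda>i. \<not> i < h) id) (sel_mat n (\<lambda>i. i < h) id)"
proof -
  have n: "n = 2 * h"
    using assms by (cases N) auto
  have p0: "proj 0 \<otimes>\<^sub>K 1\<^sub>m h = sel_mat n (\<lambda>i. i < h) id"
    by (subst kron_qubit[of _ _ h]) (auto simp: sel_mat_def n intro!: eq_matI)
  have p1: "proj 1 \<otimes>\<^sub>K 1\<^sub>m h = sel_mat n (\<lambda>i. \<not> i < h) id"
    by (subst kron_qubit[of _ _ h]) (auto simp: sel_mat_def n intro!: eq_matI)
  have "C_out N = 1\<^sub>m 2 \<otimes>\<^sub>K sel_mat n (\<lambda>i. i < h) id + sigma_x \<otimes>\<^sub>K sel_mat n (\<lambda>i. \<not> i < h) id"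
    unfolding C_out_def h_def[symmetric] p0[symmetric] p1[symmetric] kron_assoc[symmetric]
    by (rule kron_add_left[of _ "2 * 2" "2 * 2"]) (intro kron_carrier; simp)+
  then show ?thesis
    by (simp add: kron_qubit[of _ _ n] add_four_block_mat[of _ n n _ n _ n])
       (intro cong_four_block_mat eq_matI, auto)
qed

text \<open>The ancilla is only a control here, hence the diagonal form. Flipping the leading digit
  in the block of ancilla value 0 exchanges the two halves of the index range.\<close>

lemma C_in_four_block:
  assumes "1 \<le> N"
  defines "n \<equiv> 2 ^ N" and "h \<equiv> 2 ^ (N - 1)"
  shows "C_in N = four_block_mat (sel_mat n (\<lambda>_. True) (\<lambda>i. if i < h then i + h else i - h)) (0\<^sub>m n n)
    (0\<^sub>m n n) (1\<^sub>m n)"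
proof -
  let ?X = "sel_mat n (\<lambda>_. True) (\<lambda>i. if i < h then i + h else i - h)"
  have n: "n = 2 * h"
    using assms by (cases N) auto
  have one: "1\<^sub>m 2 \<otimes>\<^sub>K 1\<^sub>m h = 1\<^sub>m n"
    by (subst kron_qubit[of _ _ h]) (auto simp: n intro!: eq_matI)
  have flip: "sigma_x \<otimes>\<^sub>K 1\<^sub>m h = ?X"
    by (subst kron_qubit[of _ _ h]) (auto simp: sel_mat_def n intro!: eq_matI)
  have "C_in N = proj 1 \<otimes>\<^sub>K 1\<^sub>m n + proj 0 \<otimes>\<^sub>K ?X"
    unfolding C_in_def h_def[symmetric] one[symmetric] flip[symmetric] kron_assoc[symmetric]
    by (rule kron_add_left[of _ "2 * 2" "2 * 2"]) (intro kron_carrier; simp)+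
  then show ?thesis
    by (simp add: kron_qubit[of _ _ n] add_four_block_mat[of _ n n _ n _ n])
       (intro cong_four_block_mat eq_matI, auto)
qed

text \<open>Row \<open>i\<close> of the product is row \<open>f i\<close> of the right factor, which
  in turn points to \<open>g (f i)\<close>; hence the maps compose in the order opposite to the
  matrices.\<close>

lemma sel_mat_mult:
  assumes "\<And>i. i < n \<Longrightarrow> D i \<Longrightarrow> f i < n"
  shows "sel_mat n D f * sel_mat n E g = sel_mat n (\<lambda>i. D i \<and> E (f i)) (g \<circ> f)"
  using assms
  by (intro eq_matI)
    (auto simp: scalar_prod_def sel_mat_def if_distrib[of "\<lambda>x. x * _"] cong: if_cong)

section \<open>The control step as a conjugated reset, and its covariance\<close>

text \<open>The second block column of \<open>U_tot\<close> gives the Kraus operators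
  \<open>U * (X * P1) * mat_adjoint U\<close> and \<open>U * P0 * mat_adjoint U\<close>. Between the
  outer factors, \<open>P0\<close> keeps the |0> half and \<open>X * P1\<close> moves the |1> half
  onto it; the two contributions add up to \<open>reset_half\<close>.\<close>

lemma control_step_eq:
  assumes N: "1 \<le> N" and U: "U \<in> carrier_mat (2 ^ N) (2 ^ N)" and \<rho>: "\<rho> \<in> carrier_mat (2 ^ N) (2 ^ N)"
  shows "control_step N U \<rho> =
    U * reset_half (2 ^ (N - 1)) (mat_adjoint U * \<rho> * U) * mat_adjoint U"
proof -
  define n h :: nat where "n = 2 ^ N" and "h = 2 ^ (N - 1)"
  have n: "n = 2 * h"
    unfolding n_def h_def using N by (cases N) auto
  have [simp]: "U \<in> carrier_mat n n" "\<rho> \<in> carrier_mat n n"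
    using U \<rho> by (simp_all add: n_def)
  define flip where "flip = (\<lambda>i. if i < h then i + h else i - h)"
  define X P0 P1 where "X = sel_mat n (\<lambda>_. True) flip"
    and "P0 = sel_mat n (\<lambda>i. i < h) id" and "P1 = sel_mat n (\<lambda>i. \<not> i < h) id"
  have [simp]: "X \<in> carrier_mat n n" "P0 \<in> carrier_mat n n" "P1 \<in> carrier_mat n n"
    by (simp_all add: X_def P0_def P1_def)
  have conj_U: "four_block_mat U (0\<^sub>m n n) (0\<^sub>m n n) U = 1\<^sub>m 2 \<otimes>\<^sub>K U"
    if "U \<in> carrier_mat n n" for U
    using that by (subst kron_qubit[of _ _ n]) (auto intro!: cong_four_block_mat)
  have "U_tot N U = four_block_mat U (0\<^sub>m n n) (0\<^sub>m n n) U * four_block_mat X (0\<^sub>m n n) (0\<^sub>m n n) (1\<^sub>m n)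
    * four_block_mat P0 P1 P1 P0 * four_block_mat (mat_adjoint U) (0\<^sub>m n n) (0\<^sub>m n n) (mat_adjoint U)"
    unfolding U_tot_def C_in_four_block[OF N, folded n_def h_def]
      C_out_four_block[OF N, folded n_def h_def] X_def P0_def P1_def flip_def
    by (simp add: conj_U)
  also have "\<dots> = four_block_mat (U * (X * P0) * mat_adjoint U) (U * (X * P1) * mat_adjoint U)
    (U * P1 * mat_adjoint U) (U * P0 * mat_adjoint U)"
    by (simp add: mult_four_block_mat[of _ n n _ n _ n _ _ n _ n] assoc_mult_mat[of _ n n _ n _ n]
      left_mult_zero_mat[of _ n n] right_mult_zero_mat[of _ n n] left_mult_one_mat[of _ n n]
      left_add_zero_mat[of _ n n] right_add_zero_mat[of _ n n])
  finally have U_tot: "U_tot N U = \<dots>" .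
  define \<sigma> where "\<sigma> = mat_adjoint U * \<rho> * U"
  have [simp]: "\<sigma> \<in> carrier_mat n n"
    by (simp add: \<sigma>_def)
  have conj: "U * K * mat_adjoint U * \<rho> * mat_adjoint (U * K * mat_adjoint U) =
    U * (K * \<sigma> * mat_adjoint K) * mat_adjoint U" if [simp]: "K \<in> carrier_mat n n" for K
    by (simp add: \<sigma>_def mat_adjoint_mult[of _ n n _ n] assoc_mult_mat[of _ n n _ n _ n])
  \<comment> \<open>A row of \<open>X\<close> below \<open>h\<close> reads a row of
    \<open>P1\<close> in the upper half, which survives; a row from \<open>h\<close> on reads a row
    in the lower half, which is zero.\<close>
  have XP1: "X * P1 = sel_mat n (\<lambda>i. i < h) (\<lambda>i. i + h)"
    unfolding X_def P1_def
    by (subst sel_mat_mult) (auto simp: flip_def n sel_mat_def intro!: eq_matI)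
  have sum1: "sel_mat n (\<lambda>i. i < h) (\<lambda>i. i + h) * \<sigma> * mat_adjoint (sel_mat n (\<lambda>i. i < h) (\<lambda>i. i + h)) =
    mat n n (\<lambda>(i, j). if i < h \<and> j < h then \<sigma> $$ (i + h, j + h) else 0)"
    by (rule sel_mat_conj) (auto simp: n[symmetric], simp add: n)
  have sum2: "sel_mat n (\<lambda>i. i < h) id * \<sigma> * mat_adjoint (sel_mat n (\<lambda>i. i < h) id) =
    mat n n (\<lambda>(i, j). if i < h \<and> j < h then \<sigma> $$ (i, j) else 0)"
    by (subst sel_mat_conj) auto
  have "control_step N U \<rho> = U * (X * P1 * \<sigma> * mat_adjoint (X * P1)) * mat_adjoint U
    + U * (P0 * \<sigma> * mat_adjoint P0) * mat_adjoint U"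
    unfolding control_step_def U_tot n_def[symmetric]
    by (subst ptrace_qubit_conj) (simp_all add: conj)
  also have "\<dots> = U * (X * P1 * \<sigma> * mat_adjoint (X * P1) + P0 * \<sigma> * mat_adjoint P0) * mat_adjoint U"
    by (simp add: mult_add_distrib_mat[of _ n n _ n] add_mult_distrib_mat[of _ n n _ _ n])
  also have "X * P1 * \<sigma> * mat_adjoint (X * P1) + P0 * \<sigma> * mat_adjoint P0 = reset_half h \<sigma>"
    unfolding XP1 P0_def sum1 sum2 by (auto simp: reset_half_def n intro!: eq_matI)
  finally show ?thesis
    by (simp add: \<sigma>_def h_def)
qed

lemma reset_half_carrier [simp]: "reset_half h X \<in> carrier_mat (2 * h) (2 * h)"
  by (simp add: reset_half_def)

lemma control_step_carrier:
  "control_step N U \<rho> \<in> carrier_mat (2 ^ N) (2 ^ N)"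
  by (simp add: control_step_def ptrace_qubit_def)

lemma control_step_mult_left:
  assumes "1 \<le> N" and "V \<in> carrier_mat (2 ^ N) (2 ^ N)" "P \<in> carrier_mat (2 ^ N) (2 ^ N)"
    "\<rho> \<in> carrier_mat (2 ^ N) (2 ^ N)"
  shows "control_step N (V * P) \<rho> = V * control_step N P (mat_adjoint V * \<rho> * V) * mat_adjoint V"
proof -
  define n :: nat where "n = 2 ^ N"
  note [simp] = assms[folded n_def]
  define h :: nat where "h = 2 ^ (N - 1)"
  have "n = 2 * h"
    unfolding n_def h_def using assms(1) by (cases N) auto
  then have [simp]: "reset_half h Y \<in> carrier_mat n n" for Y
    by simp
  show ?thesis
    by (simp add: control_step_eq[OF assms(1), folded n_def h_def]
      mat_adjoint_mult[of _ n n _ n] assoc_mult_mat[of _ n n _ n _ n])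
qed

lemma fold_control_step_carrier:
  "\<rho> \<in> carrier_mat (2 ^ N) (2 ^ N) \<Longrightarrow> fold (control_step N) Us \<rho> \<in> carrier_mat (2 ^ N) (2 ^ N)"
  by (induction Us arbitrary: \<rho>) (simp_all add: control_step_carrier)

text \<open>Each step outputs \<open>V * \<tau> * mat_adjoint V\<close>, and the next one first
  undoes this conjugation, so only the initial and the final change of basis remain. For the empty
  list these two cancel each other.\<close>

lemma fold_control_step_mult_left:
  assumes N: "1 \<le> N" and V: "is_unitary (2 ^ N) V"
    and "\<And>P. P \<in> set Ps \<Longrightarrow> P \<in> carrier_mat (2 ^ N) (2 ^ N)"
    and "\<rho> \<in> carrier_mat (2 ^ N) (2 ^ N)"
  shows "fold (control_step N) (map ((*) V) Ps) \<rho> =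
    V * fold (control_step N) Ps (mat_adjoint V * \<rho> * V) * mat_adjoint V"
  using assms(3,4)
proof (induction Ps arbitrary: \<rho>)
  define n :: nat where "n = 2 ^ N"
  note V' = V[folded n_def]
  note [simp] = is_unitaryD(1)[OF V']
  \<comment> \<open>Products are normalised to right-nested form, where an inverse pair may stand at
    the head of a longer product.\<close>
  have cancel: "A * (B * C) = C" if "A * B = 1\<^sub>m n" "A \<in> carrier_mat n n" "B \<in> carrier_mat n n"
    "C \<in> carrier_mat n n" for A B C :: "complex mat"
    using that by (simp flip: assoc_mult_mat[of _ n n _ n _ n])
  note cancel = is_unitaryD(2,3)[OF V'] cancel[OF is_unitaryD(2)[OF V']] cancel[OF is_unitaryD(3)[OF V']]
  {
    case Nil
    then have [simp]: "\<rho> \<in> carrier_mat n n"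
      by (simp add: n_def)
    show ?case
      by (simp add: cancel assoc_mult_mat[of _ n n _ n _ n] right_mult_one_mat[of _ n n])
  next
    case (Cons P Ps)
    define \<tau> where "\<tau> = control_step N P (mat_adjoint V * \<rho> * V)"
    have [simp]: "\<tau> \<in> carrier_mat n n"
      by (simp add: \<tau>_def control_step_carrier n_def)
    have "control_step N (V * P) \<rho> = V * \<tau> * mat_adjoint V"
      unfolding \<tau>_def
      using Cons.prems is_unitaryD(1)[OF V] N by (intro control_step_mult_left) auto
    moreover have "mat_adjoint V * (V * \<tau> * mat_adjoint V) * V = \<tau>"
      by (simp add: cancel assoc_mult_mat[of _ n n _ n _ n] right_mult_one_mat[of _ n n])
    moreover have "V * \<tau> * mat_adjoint V \<in> carrier_mat (2 ^ N) (2 ^ N)"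
      unfolding n_def[symmetric] by simp
    ultimately show ?case
      using Cons.IH[of "V * \<tau> * mat_adjoint V"] Cons.prems by (simp add: \<tau>_def)
  }
qed

section \<open>One step halves the support\<close>

text \<open>For \<open>m = h\<close> this is the identity; for \<open>2 * m \<le> h\<close> it exchanges the blocks \<open>{m..<2 * m}\<close> and
  \<open>{h..<h + m}\<close>.\<close>

definition block_swap :: "nat \<Rightarrow> nat \<Rightarrow> nat \<Rightarrow> nat" where
  "block_swap h m i = (if m \<le> i \<and> i < 2 * m then i - m + h else
     if h \<le> i \<and> i < h + m then i - h + m else i)"

lemma block_swap_less: "m \<le> h \<Longrightarrow> i < 2 * h \<Longrightarrow> block_swap h m i < 2 * h"
  by (auto simp: block_swap_def)

text \<open>The two blocks coincide, and the shift is by zero, or they are disjoint and change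
  places. The assumption rules out a partial overlap.\<close>

lemma block_swap_involution:
  "m = h \<or> 2 * m \<le> h \<Longrightarrow> block_swap h m (block_swap h m i) = i"
  by (auto simp: block_swap_def)

text \<open>Transposing a permutation matrix inverts the permutation, and an involution is its own
  inverse.\<close>

lemma sel_mat_involution:
  assumes "\<And>i. i < n \<Longrightarrow> p i < n" "\<And>i. i < n \<Longrightarrow> p (p i) = i"
  shows "mat_adjoint (sel_mat n (\<lambda>_. True) p) = sel_mat n (\<lambda>_. True) p"
    and "is_unitary n (sel_mat n (\<lambda>_. True) p)"
proof -
  show adj: "mat_adjoint (sel_mat n (\<lambda>_. True) p) = sel_mat n (\<lambda>_. True) p"
  proof (rule eq_matI)
    fix i j assume "i < dim_row (sel_mat n (\<lambda>_. True) p)" "j < dim_col (sel_mat n (\<lambda>_. True) p)"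
    then have ij: "i < n" "j < n"
      by simp_all
    have "i = p j \<longleftrightarrow> j = p i"
      using assms(2) ij by metis
    then show "mat_adjoint (sel_mat n (\<lambda>_. True) p) $$ (i, j) = sel_mat n (\<lambda>_. True) p $$ (i, j)"
      using ij by (simp add: sel_mat_def)
  qed simp_all
  have "sel_mat n (\<lambda>_. True) p * sel_mat n (\<lambda>_. True) p = 1\<^sub>m n"
    using assms by (subst sel_mat_mult) (auto simp: sel_mat_def intro!: eq_matI)
  then show "is_unitary n (sel_mat n (\<lambda>_. True) p)"
    by (simp add: is_unitary_def adj)
qed

text \<open>The permutation carries the second half of the support, \<open>{m..<2 * m}\<close>, to
  the start of the |1> half of the register. The reset then adds it onto \<open>{0..<m}\<close>,
  which the permutation fixes.\<close>

lemma control_step_block_swap: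
  assumes N: "1 \<le> N" and \<rho>: "\<rho> \<in> carrier_mat (2 ^ N) (2 ^ N)"
    and m: "m = 2 ^ (N - 1) \<or> 2 * m \<le> 2 ^ (N - 1)"
    and supp: "\<And>i j. i < 2 ^ N \<Longrightarrow> j < 2 ^ N \<Longrightarrow> 2 * m \<le> i \<or> 2 * m \<le> j \<Longrightarrow> \<rho> $$ (i, j) = 0"
  shows "control_step N (sel_mat (2 ^ N) (\<lambda>_. True) (block_swap (2 ^ (N - 1)) m)) \<rho> =
    mat (2 ^ N) (2 ^ N) (\<lambda>(i, j). if i < m \<and> j < m then \<rho> $$ (i, j) + \<rho> $$ (i + m, j + m) else 0)"
proof -
  define n h :: nat where "n = 2 ^ N" and "h = 2 ^ (N - 1)"
  have n: "n = 2 * h"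
    unfolding n_def h_def using N by (cases N) auto
  note m = m[folded h_def]
  have mh: "m \<le> h"
    using m by auto
  define p where "p = block_swap h m"
  have p: "p i < n" "p (p i) = i" if "i < n" for i
    using that mh m unfolding p_def by (simp_all add: n block_swap_less block_swap_involution)
  define P where "P = sel_mat n (\<lambda>_. True) p"
  have adj: "mat_adjoint P = P"
    unfolding P_def using p by (rule sel_mat_involution)
  have conj: "P * X * P = mat n n (\<lambda>(i, j). X $$ (p i, p j))" if "X \<in> carrier_mat n n" for X
    using sel_mat_conj[of X n "\<lambda>_. True" p] that p(1) adj by (simp add: P_def)
  have low: "p i = i \<and> p (i + h) = i + m" if "i < m" for i
    using that mh m by (auto simp: p_def block_swap_def)
  \<comment> \<open>For \<open>m = h\<close> no such \<open>i\<close> exists. Otherwise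
    \<open>{m..<2 * m}\<close> is sent beyond \<open>h\<close>, which forces
    \<open>2 * m \<le> i\<close>; and \<open>p i + h\<close> is at least \<open>h + m\<close>, where
    \<open>p\<close> fixes every index.\<close>
  have high: "2 * m \<le> i \<and> 2 * m \<le> p (p i + h)" if "m \<le> i" "i < n" "p i < h" for i
    using that mh m unfolding p_def block_swap_def n by (auto split: if_splits)
  have "control_step N P \<rho> = P * reset_half h (P * \<rho> * P) * P"
    using control_step_eq[OF N _ \<rho>, of P] adj by (simp add: P_def n_def h_def)
  also have "\<dots> = mat n n (\<lambda>(i, j). if i < m \<and> j < m then \<rho> $$ (i, j) + \<rho> $$ (i + m, j + m) else 0)"
  proof (rule eq_matI, goal_cases)
    case (1 i j)
    then have ij: "i < n" "j < n"
      by simp_all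
    have "(P * reset_half h (P * \<rho> * P) * P) $$ (i, j) = reset_half h (P * \<rho> * P) $$ (p i, p j)"
      using ij by (subst conj) (simp_all add: n)
    also have "\<dots> = (if p i < h \<and> p j < h
      then \<rho> $$ (i, j) + \<rho> $$ (p (p i + h), p (p j + h)) else 0)"
      using ij p \<rho> unfolding n_def[symmetric] by (simp add: conj reset_half_def n)
    also have "\<dots> = (if i < m \<and> j < m then \<rho> $$ (i, j) + \<rho> $$ (i + m, j + m) else 0)"
    proof (cases "i < m \<and> j < m")
      case True
      then show ?thesis
        using low mh by simp
    next
      case False
      \<comment> \<open>A coordinate that is at least \<open>m\<close> leads outside the support in
        both summands.\<close>
      have "\<rho> $$ (i, j) + \<rho> $$ (p (p i + h), p (p j + h)) = 0" if "p i < h" "p j < h"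
      proof -
        have "2 * m \<le> i \<and> 2 * m \<le> p (p i + h) \<or> 2 * m \<le> j \<and> 2 * m \<le> p (p j + h)"
          using False high ij that by (meson not_le)
        moreover have "p (p i + h) < n" "p (p j + h) < n"
          using that p(1) by (simp_all add: n)
        ultimately show ?thesis
          using supp[folded n_def] ij by (metis add.left_neutral)
      qed
      with False show ?thesis
        by auto
    qed
    finally show ?case
      using ij by simp
  qed (simp_all add: P_def)
  finally show ?thesis
    by (simp add: P_def p_def n_def h_def)
qed

section \<open>Iterated halving\<close>

text \<open>The invariant records that after \<open>k\<close> steps the matrix lives on the first
  \<open>2 ^ (N - k)\<close> basis states and carries its whole trace there. The list is chosen
  before \<open>\<rho>\<close>, so the same unitaries serve all inputs.\<close>

lemma concentrating_steps:
  assumes N: "1 \<le> N" and "k \<le> N"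
  shows "\<exists>Ps. length Ps = k \<and> (\<forall>P \<in> set Ps. is_unitary (2 ^ N) P) \<and>
    (\<forall>\<rho> \<in> carrier_mat (2 ^ N) (2 ^ N). mat_trace \<rho> = 1 \<longrightarrow>
      (\<forall>i < 2 ^ N. \<forall>j < 2 ^ N. 2 ^ (N - k) \<le> i \<or> 2 ^ (N - k) \<le> j \<longrightarrow>
        fold (control_step N) Ps \<rho> $$ (i, j) = 0) \<and>
      (\<Sum>i < 2 ^ (N - k). fold (control_step N) Ps \<rho> $$ (i, i)) = 1)"
  using \<open>k \<le> N\<close>
proof (induction k)
  case 0
  show ?case
    by (intro exI[of _ "[]"]) (auto simp: mat_trace_def)
next
  case (Suc k)
  define n h m :: nat where "n = 2 ^ N" and "h = 2 ^ (N - 1)" and "m = 2 ^ (N - Suc k)"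
  have n: "n = 2 * h"
    unfolding n_def h_def using N by (cases N) auto
  have m2: "2 ^ (N - k) = 2 * m"
    using Suc.prems by (simp add: m_def Suc_diff_Suc flip: power_Suc)
  \<comment> \<open>In the first step all basis states may be occupied and the permutation is the
    identity; afterwards the support \<open>2 * m\<close> fits into one half of the
    register.\<close>
  have m: "m = h \<or> 2 * m \<le> h"
  proof (cases k)
    case (Suc k')
    have "2 * m \<le> h"
      unfolding m2[symmetric] h_def using Suc by (intro power_increasing) auto
    then show ?thesis ..
  qed (simp add: m_def h_def)
  then have mn: "2 * m \<le> n"
    using n by auto
  obtain Ps where Ps: "length Ps = k" "\<forall>P \<in> set Ps. is_unitary n P"
    and supp: "\<And>\<rho> i j. \<rho> \<in> carrier_mat n n \<Longrightarrow> mat_trace \<rho> = 1 \<Longrightarrow> i < n \<Longrightarrow> j < n \<Longrightarrow>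
      2 * m \<le> i \<or> 2 * m \<le> j \<Longrightarrow> fold (control_step N) Ps \<rho> $$ (i, j) = 0"
    and tr: "\<And>\<rho>. \<rho> \<in> carrier_mat n n \<Longrightarrow> mat_trace \<rho> = 1 \<Longrightarrow>
      (\<Sum>i < 2 * m. fold (control_step N) Ps \<rho> $$ (i, i)) = 1"
    using Suc.IH[OF Suc_leD[OF Suc.prems], unfolded m2, folded n_def] by blast
  define P where "P = sel_mat n (\<lambda>_. True) (block_swap h m)"
  have P: "is_unitary n P"
    unfolding P_def using m
    by (intro sel_mat_involution) (auto simp: n block_swap_less block_swap_involution)
  have step: "fold (control_step N) (Ps @ [P]) \<rho> = mat n n (\<lambda>(i, j). if i < m \<and> j < m
      then fold (control_step N) Ps \<rho> $$ (i, j) + fold (control_step N) Ps \<rho> $$ (i + m, j + m) else 0)"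
    if \<rho>: "\<rho> \<in> carrier_mat n n" "mat_trace \<rho> = 1" for \<rho>
    using control_step_block_swap[OF N fold_control_step_carrier, folded n_def h_def, OF \<rho>(1) m supp[OF \<rho>]]
    by (simp add: P_def)
  have "(\<Sum>i<m. fold (control_step N) (Ps @ [P]) \<rho> $$ (i, i)) = 1"
    if \<rho>: "\<rho> \<in> carrier_mat n n" "mat_trace \<rho> = 1" for \<rho>
  proof -
    let ?f = "\<lambda>i. fold (control_step N) Ps \<rho> $$ (i, i)"
    \<comment> \<open>The new diagonal superposes the two halves of the old one, so its sum is the
      old sum over \<open>{..<2 * m}\<close>.\<close>
    have "(\<Sum>i<m. fold (control_step N) (Ps @ [P]) \<rho> $$ (i, i)) = (\<Sum>i<m. ?f i + ?f (i + m))"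
      using mn by (simp only: step[OF \<rho>]) (intro sum.cong, auto)
    also have "\<dots> = (\<Sum>i<m. ?f i) + (\<Sum>i=m..<m + m. ?f i)"
      by (simp add: sum.distrib sum.shift_bounds_nat_ivl[of ?f 0 m m, simplified] atLeast0LessThan)
    also have "\<dots> = (\<Sum>i<2 * m. ?f i)"
      unfolding mult_2 atLeast0LessThan[symmetric] by (rule sum.atLeastLessThan_concat) auto
    finally show ?thesis
      using tr[OF \<rho>] by simp
  qed
  moreover have "fold (control_step N) (Ps @ [P]) \<rho> $$ (i, j) = 0"
    if "\<rho> \<in> carrier_mat n n" "mat_trace \<rho> = 1" "i < n" "j < n" "m \<le> i \<or> m \<le> j" for \<rho> i j
    using that by (simp only: step) auto
  ultimately show ?case
    unfolding n_def[symmetric] m_def[symmetric] using Ps P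
    by (intro exI[of _ "Ps @ [P]"]) auto
qed

section \<open>A unitary with prescribed first column\<close>

text \<open>Gram-Schmidt applied to a basis starting with \<open>\<psi>\<close> keeps
  \<open>\<psi>\<close> in front. Normalising the resulting orthogonal vectors gives the columns of
  a unitary, and leaves the unit vector \<open>\<psi>\<close> unchanged.\<close>

lemma unitary_completion:
  fixes \<psi> :: "complex vec"
  assumes \<psi>: "\<psi> \<in> carrier_vec n" and norm: "\<psi> \<bullet>c \<psi> = 1"
  obtains V where "is_unitary n V" "col V 0 = \<psi>"
proof -
  interpret cof_vec_space n "TYPE(complex)" .
  have \<psi>0: "\<psi> \<noteq> 0\<^sub>v n"
    using norm \<psi> by auto
  have n: "0 < n"
    using \<psi> norm by (cases n) (auto simp: scalar_prod_def)
  define us where "us = gram_schmidt n (basis_completion \<psi>)"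
  note basis = basis_completion[OF \<psi> \<psi>0]
  have us: "corthogonal us" "set us \<subseteq> carrier_vec n" "length us = n"
    using gram_schmidt_result[OF basis(2,4,5) us_def] basis(6) by auto
  have "hd us = \<psi>"
    using gram_schmidt_hd[OF \<psi>] by (simp add: us_def basis_completion_def Let_def)
  then have us0: "us ! 0 = \<psi>"
    using us(3) n by (cases us) auto
  have [simp]: "us ! i \<in> carrier_vec n" "dim_vec (us ! i) = n" if "i < n" for i
    using us(2,3) that nth_mem by fastforce+
  \<comment> \<open>The squared norm is real and nonnegative, so \<open>Re\<close> loses
    nothing.\<close>
  define c :: "nat \<Rightarrow> complex" where "c i = of_real (1 / sqrt (Re (us ! i \<bullet>c us ! i)))" for i
  define V where "V = mat n n (\<lambda>(i, j). c j * us ! j $ i)"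
  have V: "V \<in> carrier_mat n n"
    by (simp add: V_def)
  have "mat_adjoint V * V = 1\<^sub>m n"
  proof (rule eq_matI, goal_cases)
    case (1 i j)
    then have ij: "i < n" "j < n"
      by simp_all
    have "(mat_adjoint V * V) $$ (i, j) = c i * c j * (us ! j \<bullet>c us ! i)"
      using ij by (auto simp: V_def scalar_prod_def sum_distrib_left c_def intro!: sum.cong)
    also have "\<dots> = (if i = j then 1 else 0)"
    proof (cases "i = j")
      case True
      have "us ! i \<bullet>c us ! i \<noteq> 0"
        using corthogonalD[OF us(1)] ij us(3) by simp
      moreover have "us ! i \<bullet>c us ! i \<ge> 0"
        by (rule conjugate_square_ge_0_vec)
      ultimately obtain r where r: "us ! i \<bullet>c us ! i = of_real r" "r > 0"
        by (auto simp: less_eq_complex_def complex_eq_iff intro!: that[of "Re (us ! i \<bullet>c us ! i)"])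
      have "c i * c i * of_real r = of_real (1 / sqrt r * (1 / sqrt r) * r)"
        by (simp only: c_def r(1) Re_complex_of_real of_real_mult)
      also have "\<dots> = 1"
        using r(2) by simp
      finally show ?thesis
        using True r(1) by simp
    next
      case False
      then show ?thesis
        using corthogonalD[OF us(1)] ij us(3) by simp
    qed
    finally show ?case
      using ij by simp
  qed (use V in auto)
  then have "is_unitary n V"
    using V mat_mult_left_right_inverse[of "mat_adjoint V" n V] by (simp add: is_unitary_def)
  moreover have "col V 0 = \<psi>"
    using n \<psi> us0 norm by (intro eq_vecI) (auto simp: V_def c_def)
  ultimately show ?thesis
    by (rule that)
qed

section \<open>Preparation of an arbitrary pure state\<close>

theorem theorem3p1:
  fixes N :: nat and \<psi> :: "complex vec"
  assumes "1 \<le> N"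
    and "\<psi> \<in> carrier_vec (2 ^ N)"
    and "\<psi> \<bullet>c \<psi> = 1"
  shows "\<exists>Us. length Us = N \<and> (\<forall>U \<in> set Us. is_unitary (2 ^ N) U) \<and>
    (\<forall>\<rho>. density_operator (2 ^ N) \<rho> \<longrightarrow> fold (control_step N) Us \<rho> = ketbra \<psi> \<psi>)"
proof -
  define n :: nat where "n = 2 ^ N"
  have n0: "0 < n"
    by (simp add: n_def)
  obtain V where V: "is_unitary n V" and \<psi>: "col V 0 = \<psi>"
    using unitary_completion assms(2,3) unfolding n_def by blast
  note [simp] = is_unitaryD(1)[OF V] carrier_matD[OF is_unitaryD(1)[OF V]]
  obtain Ps where Ps: "length Ps = N" "\<And>P. P \<in> set Ps \<Longrightarrow> is_unitary n P"
    and supp: "\<And>\<rho> i j. \<rho> \<in> carrier_mat n n \<Longrightarrow> mat_trace \<rho> = 1 \<Longrightarrow> i < n \<Longrightarrow> j < n \<Longrightarrow>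
      1 \<le> i \<or> 1 \<le> j \<Longrightarrow> fold (control_step N) Ps \<rho> $$ (i, j) = 0"
    and tr: "\<And>\<rho>. \<rho> \<in> carrier_mat n n \<Longrightarrow> mat_trace \<rho> = 1 \<Longrightarrow>
      (\<Sum>i<1. fold (control_step N) Ps \<rho> $$ (i, i)) = 1"
    using concentrating_steps[OF assms(1) order_refl, folded n_def, unfolded diff_self_eq_0 power_0]
    by blast
  have "fold (control_step N) (map ((*) V) Ps) \<rho> = ketbra \<psi> \<psi>" if "density_operator n \<rho>" for \<rho>
  proof -
    have \<rho>: "\<rho> \<in> carrier_mat n n" "mat_trace \<rho> = 1"
      using that by (simp_all add: density_operator_def pos_semidef_def)
    define \<sigma> where "\<sigma> = mat_adjoint V * \<rho> * V"
    have \<sigma>: "\<sigma> \<in> carrier_mat n n"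
      using \<rho> by (simp add: \<sigma>_def)
    \<comment> \<open>Cyclicity of the trace brings \<open>V\<close> next to its adjoint, so the
      change of basis preserves trace one.\<close>
    have "mat_trace \<sigma> = mat_trace (V * (mat_adjoint V * \<rho>))"
      unfolding \<sigma>_def using \<rho> by (intro mat_trace_comm[of _ n n]) simp_all
    also have "V * (mat_adjoint V * \<rho>) = V * mat_adjoint V * \<rho>"
      using \<rho> by (simp add: assoc_mult_mat[of _ n n _ n _ n])
    finally have tr\<sigma>: "mat_trace \<sigma> = 1"
      using \<rho> is_unitaryD(3)[OF V] by simp
    \<comment> \<open>After \<open>N\<close> steps the support has size \<open>2 ^ 0 = 1\<close>, so
      the trace condition fixes the only remaining entry.\<close>
    have E: "fold (control_step N) Ps \<sigma> = mat n n (\<lambda>(i, j). if i = 0 \<and> j = 0 then 1 else 0)" (is "_ = ?E")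
      using fold_control_step_carrier[of \<sigma> N Ps] \<sigma>
      by (intro eq_matI) (auto simp: supp[OF \<sigma> tr\<sigma>] tr[OF \<sigma> tr\<sigma>, simplified] simp flip: n_def)
    have VE: "V * ?E = mat n n (\<lambda>(i, j). if j = 0 then V $$ (i, 0) else 0)"
      using n0
      by (intro eq_matI) (auto simp: scalar_prod_def if_distrib[of "\<lambda>x. _ * x"] cong: if_cong)
    have "fold (control_step N) (map ((*) V) Ps) \<rho> = V * ?E * mat_adjoint V"
      using fold_control_step_mult_left[OF assms(1), folded n_def, OF V _ \<rho>(1), of Ps]
        is_unitaryD(1)[OF Ps(2)] E by (simp add: \<sigma>_def)
    \<comment> \<open>Conjugating the projector onto the first basis vector by \<open>V\<close>
      gives the projector onto the first column of \<open>V\<close>.\<close>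
    also have "\<dots> = ketbra \<psi> \<psi>"
      unfolding VE \<psi>[symmetric] using n0
      by (intro eq_matI)
        (auto simp: ketbra_def scalar_prod_def if_distrib[of "\<lambda>x. x * _"] cong: if_cong)
    finally show ?thesis .
  qed
  then show ?thesis
    unfolding n_def[symmetric] using Ps is_unitary_mult[OF V]
    by (intro exI[of _ "map ((*) V) Ps"]) auto
qed

end
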